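(* For $0<\sigma<1$, $t>0$ and $0<\delta_1<1$ let $$I_1(\sigma,t,\delta_1)=\frac{t}{\pi}\int_{-t^{\delta_1-1}}^{1/t}\Re\left\{\frac{\Gamma(it-it\tau)}{\Gamma(\sigma+it)}\,\Gamma(\sigma+it\tau)\right\}|\zeta(\sigma+it\tau)|^2\,d\tau.$$ Then, for sufficiently small $\delta_1$, $$I_1(\sigma,t,\delta_1)=\begin{cases}O\left(\dfrac{t^{\left(2-\frac43\sigma\right)\delta_1}}{t^{\sigma}}\right), & 0<\sigma\le\frac12,\\[3mm] O\left(\dfrac{t^{\left(\frac53-\frac23\sigma\right)\delta_1}}{t^{\sigma}}\right), & \frac12<\sigma<1,\end{cases}\qquad t\to\infty.$$
   Context: $\Gamma$ is the gamma function and $\zeta$ the Riemann zeta function (analytically continued). *)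

theory Defs
  imports "HOL-Complex_Analysis.Complex_Analysis" "HOL-Library.Landau_Symbols"
begin

text \<open>
  The Riemann zeta function as the unique analytic continuation of its Dirichlet series from
  \<open>Re s > 1\<close> to the plane punctured at 1. The value 0 at the pole is a mere convention that
  makes the total function unique.
\<close>
definition zeta :: "complex \<Rightarrow> complex" where
  "zeta = (THE f. f holomorphic_on (- {1}) \<and>
                  (\<forall>s. Re s > 1 \<longrightarrow> f s = (\<Sum>n. 1 / of_nat (Suc n) powr s)) \<and>
                  f 1 = 0)"

definition I1 :: "real \<Rightarrow> real \<Rightarrow> real \<Rightarrow> real" where
  "I1 \<sigma> t \<delta>\<^sub>1 = t / pi *
     integral {- (t powr (\<delta>\<^sub>1 - 1)) .. 1 / t}
       (\<lambda>\<tau>. Re (Gamma (\<i> * of_real t - \<i> * of_real t * of_real \<tau>)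
                   / Gamma (of_real \<sigma> + \<i> * of_real t)
                 * Gamma (of_real \<sigma> + \<i> * of_real t * of_real \<tau>))
            * (cmod (zeta (of_real \<sigma> + \<i> * of_real t * of_real \<tau>)))\<^sup>2)"

end

theory Submission
  imports Defs
begin

text \<open>
  Write \<open>\<rho> = t * \<tau>\<close>, so that \<open>\<rho> \<le> 1\<close> on the whole range of integration. The quotient
  \<open>\<Gamma>(\<i> (t - \<rho>)) / \<Gamma>(\<sigma> + \<i> t)\<close> is of order at most \<open>t powr (-\<sigma>) * exp (pi * \<rho> / 2)\<close>: by Stirling's formula
  both Gamma factors decay exponentially in their imaginary parts, and these differ by \<open>\<rho>\<close>. The factor
  \<open>\<Gamma>(\<sigma> + \<i> \<rho>)\<close> is bounded by \<open>\<Gamma>(\<sigma>)\<close>, and \<open>\<zeta>(\<sigma> + \<i> \<rho>)\<close> grows at most linearly in \<open>\<rho>\<close>. For negative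
  \<open>\<rho>\<close> the exponential thus dominates everything else, the integral over \<open>\<rho>\<close> converges absolutely up to
  \<open>-\<infinity>\<close>, and the integral in question is \<open>O(t powr (-\<sigma>))\<close> irrespective of \<open>\<delta>\<^sub>1\<close> (lemma \<open>I1_bound\<close>). This is
  stronger than both claimed bounds, whose additional factor is a nonnegative power of \<open>t\<close>.

  Two ingredients carry the argument. The first is the analytic continuation of zeta together with its
  growth in the critical strip. Both come from one identity (\<open>dirichlet_shift\<close>), obtained by summing the
  Taylor expansion of \<open>(n + 1) powr (-s)\<close> at \<open>n\<close>: it expresses \<open>(s - 1) \<zeta>(s)\<close> by its values further to
  the right and a series of Taylor remainders, which converges in a larger half-plane. Iteration gives an
  entire function, so that the definite description in the definition of zeta denotes it; the
  simplest instance of the identity gives the growth bound (\<open>zeta_vertical_growth\<close>).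

  The second ingredient is the Stirling-type bound for the Gamma quotient (\<open>Gamma_quotient_bound\<close>). On the imaginary
  axis the modulus of Gamma is explicit by the reflection formula. The passage to real part \<open>\<sigma>\<close> is made in
  Euler's product, whose factors at real part \<open>x \<in> [0, 1]\<close> are, up to summable errors, bounded by the geometric
  interpolation of those at real parts 0 and 1, and the interpolated product telescopes
  (\<open>rGamma_vertical_comparison\<close>).
\<close>

section \<open>Continuation and growth of the zeta function\<close>

definition dirichlet :: "complex \<Rightarrow> complex" where
  "dirichlet s = (\<Sum>n. 1 / of_nat (Suc n) powr s)"

text \<open>
  The Taylor remainder of order \<open>m\<close> of \<open>x \<mapsto> x powr (-s)\<close>, expanded at \<open>Suc n\<close> and evaluated
  one unit to the right.
\<close>
definition powr_rem :: "nat \<Rightarrow> complex \<Rightarrow> nat \<Rightarrow> complex" where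
  "powr_rem m s n = of_nat (Suc (Suc n)) powr (-s)
     - (\<Sum>k<m. (-s gchoose k) * of_nat (Suc n) powr (-s - of_nat k))"

lemma norm_of_nat_Suc_powr:
  "norm (of_nat (Suc n) powr s :: complex) = real (Suc n) powr Re s"
  by (subst norm_powr_real_powr) auto

lemma summable_Suc_powr: "p < -1 \<Longrightarrow> summable (\<lambda>n. real (Suc n) powr p)"
  using summable_real_powr_iff[of p] by (subst summable_Suc_iff) auto

text \<open>
  Each further Taylor term gains one power of \<open>n\<close>. This gain is what lets the series of remainders
  converge in a wider half-plane than the Dirichlet series.
\<close>
lemma norm_powr_rem_le:
  assumes "Re s + real (Suc m) \<ge> 0"
  shows "norm (powr_rem (Suc m) s n)
           \<le> real (Suc m) * norm (-s gchoose Suc m) * real (Suc n) powr (- Re s - real (Suc m))"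
proof -
  define a where "a = real (Suc n)"
  have a: "a > 0" by (simp add: a_def)
  define S where "S = {z::complex. Im z = 0 \<and> a \<le> Re z}"
  define f where "f i x = fact i * (-s gchoose i) * x powr (-s - of_nat i)" for i and x :: complex
  define B where "B = fact (Suc m) * norm (-s gchoose Suc m) * a powr (- Re s - real (Suc m))"
  have "cmod (f 0 (of_real (a+1)) - (\<Sum>i\<le>m. f i (of_real a) * (of_real (a+1) - of_real a) ^ i / fact i))
          \<le> B * cmod (of_real (a+1) - of_real a) ^ Suc m / fact m"
  proof (rule complex_Taylor[where S = S])
    show "convex S"
      unfolding S_def convex_def
    proof (clarsimp, goal_cases)
      case (1 x y u v)
      then have "a = u * a + v * a" by (simp flip: distrib_right)
      also have "\<dots> \<le> u * Re x + v * Re y" using 1 by (intro add_mono mult_left_mono)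
      finally show ?case .
    qed
  next
    fix i x assume x: "x \<in> S" and "i \<le> m"
    have "x \<notin> \<real>\<^sub>\<le>\<^sub>0" using x a by (auto simp: S_def complex_nonpos_Reals_iff)
    then have "(f i has_field_derivative fact i * (-s gchoose i) *
                  ((-s - of_nat i) * x powr (-s - of_nat i - 1))) (at x within S)"
      unfolding f_def
      by (intro DERIV_cmult has_field_derivative_at_within[OF has_field_derivative_powr])
    moreover have "(-s gchoose i) * (-s - of_nat i) = of_nat (Suc i) * (-s gchoose Suc i)"
      using gbinomial_mult_1[of "-s" i] by (simp add: algebra_simps)
    then have "fact i * (-s gchoose i) * ((-s - of_nat i) * x powr (-s - of_nat i - 1)) = f (Suc i) x"
      unfolding f_def fact_Suc of_nat_Suc diff_diff_eq add.commute[of 1] by algebra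
    ultimately show "(f i has_field_derivative f (Suc i) x) (at x within S)" by simp
  next
    fix x assume x: "x \<in> S"
    have "x \<in> \<real>" "Re x \<ge> a" using x by (auto simp: S_def complex_is_Real_iff)
    then have "norm (x powr (-s - of_nat (Suc m))) = Re x powr (- Re s - real (Suc m))"
      using a by (subst norm_powr_real_powr) auto
    also have "\<dots> \<le> a powr (- Re s - real (Suc m))"
      using assms a \<open>Re x \<ge> a\<close> by (intro powr_mono2') auto
    finally show "cmod (f (Suc m) x) \<le> B"
      unfolding f_def B_def norm_mult norm_fact by (intro mult_left_mono) auto
  qed (use a in \<open>auto simp: S_def\<close>)
  also have "(\<Sum>i\<le>m. f i (of_real a) * (of_real (a+1) - of_real a) ^ i / fact i)
               = (\<Sum>k<Suc m. (-s gchoose k) * of_real a powr (-s - of_nat k))"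
    unfolding lessThan_Suc_atMost by (intro sum.cong) (auto simp: f_def)
  also have "f 0 (of_real (a+1)) = of_nat (Suc (Suc n)) powr (-s)"
    by (simp add: f_def a_def add_ac)
  also have "complex_of_real a = of_nat (Suc n)" by (simp add: a_def)
  also have "B * cmod (of_real (a+1) - of_nat (Suc n)) ^ Suc m / fact m
               = real (Suc m) * norm (-s gchoose Suc m) * real (Suc n) powr (- Re s - real (Suc m))"
    by (simp add: B_def a_def)
  finally show ?thesis by (simp only: powr_rem_def)
qed

text \<open>
  Around every point the exponent stays below \<open>-1\<close> by a fixed margin and \<open>K\<close> stays bounded, so that
  the Weierstrass test applies locally.
\<close>
lemma holomorphic_on_power_bounded_series:
  fixes f :: "nat \<Rightarrow> complex \<Rightarrow> complex"
  assumes hol: "\<And>n. f n holomorphic_on {s. Re s > 1 - p}"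
    and K: "continuous_on {s. Re s > 1 - p} K"
    and bd: "\<And>n s. Re s > 1 - p \<Longrightarrow> norm (f n s) \<le> K s * real (Suc n) powr (- Re s - p)"
  shows "(\<lambda>s. \<Sum>n. f n s) holomorphic_on {s. Re s > 1 - p}"
proof (rule holomorphic_uniform_sequence)
  show op: "open {s. Re s > 1 - p}" by (rule open_halfspace_Re_gt)
  show "(\<lambda>s. \<Sum>i<n. f i s) holomorphic_on {s. Re s > 1 - p}" for n
    by (intro holomorphic_on_sum hol)
  fix z assume z: "z \<in> {s. Re s > 1 - p}"
  define d where "d = (Re z - (1 - p)) / 2"
  have d: "d > 0" using z by (simp add: d_def)
  have ge: "Re s \<ge> 1 - p + d" if "s \<in> cball z d" for s
    using abs_Re_le_cmod[of "z - s"] that by (simp add: dist_norm d_def field_simps)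
  have sub: "cball z d \<subseteq> {s. Re s > 1 - p}" using ge d by fastforce
  have "compact (K ` cball z d)"
    by (intro compact_continuous_image continuous_on_subset[OF K sub] compact_cball)
  then obtain C where C: "\<And>s. s \<in> cball z d \<Longrightarrow> norm (K s) \<le> C"
    using compact_imp_bounded bounded_iff by (metis imageI)
  have "uniform_limit (cball z d) (\<lambda>n x. \<Sum>i<n. f i x) (\<lambda>x. \<Sum>i. f i x) sequentially"
  proof (rule Weierstrass_m_test)
    fix n s assume s: "s \<in> cball z d"
    have "norm (f n s) \<le> K s * real (Suc n) powr (- Re s - p)" using bd sub s by auto
    also have "\<dots> \<le> C * real (Suc n) powr (- 1 - d)"
      using C[OF s] ge[OF s] order.trans[OF norm_ge_zero C[OF s]]
      by (intro mult_mono powr_mono) auto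
    finally show "norm (f n s) \<le> C * real (Suc n) powr (- 1 - d)" .
  qed (use d in \<open>intro summable_mult summable_Suc_powr, simp\<close>)
  with d sub show "\<exists>d>0. cball z d \<subseteq> {s. Re s > 1 - p} \<and>
      uniform_limit (cball z d) (\<lambda>n s. \<Sum>i<n. f i s) (\<lambda>s. \<Sum>n. f n s) sequentially" by blast
qed

lemma holomorphic_gchoose: "(\<lambda>s::complex. s gchoose k) holomorphic_on A"
  unfolding gbinomial_prod_rev by (intro holomorphic_intros) auto

lemma holomorphic_powr_rem_sum:
  "(\<lambda>s. \<Sum>n. powr_rem (Suc m) s n) holomorphic_on {s. Re s > - real m}"
proof -
  have "(\<lambda>s. \<Sum>n. powr_rem (Suc m) s n) holomorphic_on {s. Re s > 1 - real (Suc m)}"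
  proof (rule holomorphic_on_power_bounded_series)
    show "(\<lambda>s. powr_rem (Suc m) s n) holomorphic_on {s. Re s > 1 - real (Suc m)}" for n
      unfolding powr_rem_def
      by (intro holomorphic_intros holomorphic_on_compose[OF _ holomorphic_gchoose, unfolded o_def])
    show "continuous_on {s. Re s > 1 - real (Suc m)} (\<lambda>s. real (Suc m) * norm (-s gchoose Suc m))"
      by (intro continuous_intros holomorphic_on_imp_continuous_on
            holomorphic_on_compose[OF _ holomorphic_gchoose, unfolded o_def] holomorphic_intros)
  qed (rule norm_powr_rem_le, simp)
  then show ?thesis by simp
qed

lemma dirichlet_summable: "Re s > 1 \<Longrightarrow> summable (\<lambda>n. 1 / of_nat (Suc n) powr s :: complex)"
  by (rule summable_norm_cancel, unfold norm_divide norm_of_nat_Suc_powr)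
     (use summable_Suc_powr[of "- Re s"] in \<open>simp add: powr_minus_divide\<close>)

lemma holomorphic_dirichlet: "dirichlet holomorphic_on {s. Re s > 1}"
proof -
  have "(\<lambda>s. \<Sum>n. 1 / of_nat (Suc n) powr s :: complex) holomorphic_on {s. Re s > 1 - 0}"
    by (rule holomorphic_on_power_bounded_series[where K = "\<lambda>_. 1"])
       (auto intro!: holomorphic_intros simp: norm_divide norm_of_nat_Suc_powr powr_minus_divide simp del: of_nat_Suc)
  then show ?thesis by (simp add: dirichlet_def[abs_def])
qed

text \<open>
  Where everything converges absolutely, the Taylor expansion may be summed over \<open>n\<close> term by term:
  the shifted series is the Dirichlet series without its first term, and the \<open>k\<close>-th Taylor term sums
  to a binomial coefficient times the Dirichlet series at \<open>s + k\<close>.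
\<close>
lemma suminf_powr_rem:
  assumes s: "Re s > 1"
  shows "(\<Sum>n. powr_rem m s n)
    = dirichlet s - 1 - (\<Sum>k<m. (-s gchoose k) * dirichlet (s + of_nat k))"
proof -
  have e: "(of_nat N :: complex) powr (- z) = 1 / of_nat N powr z" for N z
    by (simp add: powr_minus_divide)
  have D: "(\<lambda>n. of_nat (Suc n) powr (- z)) sums dirichlet z" if "Re z > 1" for z :: complex
    unfolding e dirichlet_def using dirichlet_summable[OF that] by (rule summable_sums)
  have 1: "(\<lambda>n. of_nat (Suc (Suc n)) powr (- s)) sums (dirichlet s - 1)"
    using D[OF s] by (subst sums_Suc_iff) simp
  have 2: "(\<lambda>n. \<Sum>k<m. (-s gchoose k) * of_nat (Suc n) powr (-s - of_nat k))
             sums (\<Sum>k<m. (-s gchoose k) * dirichlet (s + of_nat k))"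
  proof (intro sums_sum sums_mult)
    fix k show "(\<lambda>n. of_nat (Suc n) powr (-s - of_nat k)) sums dirichlet (s + of_nat k)"
      using D[of "s + of_nat k"] s by simp
  qed
  show ?thesis
    using sums_diff[OF 1 2] by (simp add: sums_iff powr_rem_def)
qed

text \<open>
  Solving the summed Taylor expansion at \<open>s = w - 1\<close> for its first-order term; the terms of order 0
  cancel. The last factor of the binomial coefficient
  \<open>(1 - w) gchoose (k + 2)\<close> is \<open>- (w + k)\<close>, which is exactly the factor that removes the pole of
  \<open>\<zeta> (w + k + 1)\<close>. Hence \<open>(s - 1) \<zeta>(s)\<close> at \<open>w\<close> is expressed by values of the same function at points
  at least one unit further to the right, with holomorphic coefficients.
\<close>
lemma dirichlet_shift:
  assumes w: "Re w > 2"
  shows "(w - 1) * dirichlet w = 1 + (\<Sum>n. powr_rem (Suc (Suc j)) (w - 1) n)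
     - (\<Sum>k<j. ((1 - w) gchoose Suc k) / of_nat (k + 2)
                    * ((w + of_nat k) * dirichlet (w + of_nat k + 1)))"
proof -
  have b: "((1 - w) gchoose Suc (Suc k)) = - ((1 - w) gchoose Suc k) / of_nat (k + 2) * (w + of_nat k)" for k
  proof -
    have "of_nat (k + 2) * ((1 - w) gchoose Suc (Suc k)) = - ((1 - w) gchoose Suc k) * (w + of_nat k)"
      using gbinomial_mult_1[of "1 - w" "Suc k"]
      unfolding of_nat_Suc of_nat_add of_nat_numeral by algebra
    moreover have "of_nat (k + 2) \<noteq> (0 :: complex)" by (simp only: of_nat_eq_0_iff)
    ultimately show ?thesis
      unfolding times_divide_eq_left by (subst nonzero_eq_divide_eq) (simp_all only: mult.commute not_False_eq_True)
  qed
  have "(\<Sum>k<Suc (Suc j). ((1 - w) gchoose k) * dirichlet (w - 1 + of_nat k))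
     = dirichlet (w - 1) - (w - 1) * dirichlet w
       + (\<Sum>k<j. ((1 - w) gchoose Suc (Suc k)) * dirichlet (w + of_nat k + 1))"
    by (simp add: sum.lessThan_Suc_shift algebra_simps del: sum.lessThan_Suc)
  with suminf_powr_rem[of "w - 1" "Suc (Suc j)"] w show ?thesis
    by (simp add: b sum_negf mult.assoc del: of_nat_add)
qed

text \<open>
  Every application of the shift identity moves the boundary of the half-plane one unit to the left.
  Agreement with the Dirichlet series is asked only for \<open>Re s > 2\<close>, where the shift identity holds;
  the identity theorem gives the rest later.
\<close>
lemma continuation_halfplane:
  "\<exists>Z. Z holomorphic_on {s. Re s > 1 - real j} \<and> (\<forall>s. Re s > 2 \<longrightarrow> Z s = (s - 1) * dirichlet s)"
proof (induction j)
  case 0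
  show ?case
    by (intro exI[of _ "\<lambda>s. (s - 1) * dirichlet s"])
       (auto intro!: holomorphic_intros holomorphic_dirichlet)
next
  case (Suc j)
  then obtain Z where Z: "Z holomorphic_on {s. Re s > 1 - real j}"
    and Zeq: "\<And>s. Re s > 2 \<Longrightarrow> Z s = (s - 1) * dirichlet s" by blast
  define W where "W w = 1 + (\<Sum>n. powr_rem (Suc (Suc j)) (w - 1) n)
     - (\<Sum>k<j. ((1 - w) gchoose Suc k) / of_nat (k + 2) * Z (w + of_nat k + 1))" for w
  have "(\<lambda>w. \<Sum>n. powr_rem (Suc (Suc j)) (w - 1) n) holomorphic_on {s. Re s > 1 - real (Suc j)}"
    by (rule holomorphic_on_compose_gen[OF _ holomorphic_powr_rem_sum, unfolded o_def])
       (auto intro!: holomorphic_intros)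
  moreover have "(\<lambda>w. Z (w + of_nat k + 1)) holomorphic_on {s. Re s > 1 - real (Suc j)}" for k
    by (rule holomorphic_on_compose_gen[OF _ Z, unfolded o_def]) (auto intro!: holomorphic_intros)
  moreover have "(\<lambda>w. (1 - w) gchoose Suc k) holomorphic_on {s. Re s > 1 - real (Suc j)}" for k
    by (intro holomorphic_on_compose[OF _ holomorphic_gchoose, unfolded o_def] holomorphic_intros)
  ultimately have "W holomorphic_on {s. Re s > 1 - real (Suc j)}"
    unfolding W_def by (intro holomorphic_intros) (auto simp del: of_nat_add)
  moreover have "W w = (w - 1) * dirichlet w" if "Re w > 2" for w
    using that unfolding W_def by (subst dirichlet_shift[OF that, of j]) (simp add: Zeq)
  ultimately show ?case by blast
qed

lemma entire_continuation:
  obtains Z where "Z holomorphic_on UNIV" "\<And>s. Re s > 1 \<Longrightarrow> Z s = (s - 1) * dirichlet s"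
proof -
  obtain F where F: "\<And>j. F j holomorphic_on {s. Re s > 1 - real j}"
    and Feq: "\<And>j s. Re s > 2 \<Longrightarrow> F j s = (s - 1) * dirichlet s"
    using continuation_halfplane by metis
  have agree: "F i s = F j s" if "i \<le> j" "Re s > 1 - real i" for i j s
  proof (rule analytic_continuation_open[where s = "{s. Re s > 2}" and s' = "{s. Re s > 1 - real i}"
                                      and f = "F i" and g = "F j"])
    show "F j holomorphic_on {s. Re s > 1 - real i}"
      by (rule holomorphic_on_subset[OF F]) (use that in auto)
    show "{s. Re s > 2} \<noteq> {}" by (auto intro: exI[of _ 3])
    show "connected {s. Re s > 1 - real i}"
      by (intro convex_connected convex_halfspace_Re_gt)
  qed (use that F Feq in \<open>auto simp: open_halfspace_Re_gt\<close>)
  \<comment> \<open>Any index \<open>j\<close> with \<open>Re s > 1 - j\<close> would do; this one always qualifies.\<close>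
  define Z where "Z s = F (nat \<lceil>2 - Re s\<rceil>) s" for s
  have ZF: "Z s = F j s" if "Re s > 1 - real j" for s j
  proof -
    have "Re s > 1 - real (nat \<lceil>2 - Re s\<rceil>)" by linarith
    then show ?thesis
      unfolding Z_def using that agree[of j "nat \<lceil>2 - Re s\<rceil>" s] agree[of "nat \<lceil>2 - Re s\<rceil>" j s]
      by (cases "j \<le> nat \<lceil>2 - Re s\<rceil>") auto
  qed
  have "Z holomorphic_on (\<Union>j. {s. Re s > 1 - real j})"
  proof (rule holomorphic_on_UN_open)
    show "Z holomorphic_on {s. Re s > 1 - real j}" for j
      using F[of j] by (subst holomorphic_cong[OF refl, of _ _ "F j"]) (auto simp: ZF)
  qed (rule open_halfspace_Re_gt)
  moreover have "(\<Union>j. {s. Re s > 1 - real j}) = UNIV"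
  proof (intro equalityI subsetI UNIV_I UN_I)
    fix s :: complex
    show "s \<in> {z. Re z > 1 - real (nat \<lceil>2 - Re s\<rceil>)}" unfolding mem_Collect_eq by linarith
  qed
  moreover have "Z s = (s - 1) * dirichlet s" if "Re s > 1" for s
  proof (rule analytic_continuation_open[where s = "{s. Re s > 2}" and s' = "{s. Re s > 1}"
                                      and f = Z and g = "\<lambda>s. (s - 1) * dirichlet s"])
    show "{s. Re s > 2} \<noteq> {}" by (auto intro: exI[of _ 3])
    show "connected {s. Re s > 1}"
      by (intro convex_connected convex_halfspace_Re_gt)
    show "Z holomorphic_on {s. Re s > 1}"
      using F[of 0] by (subst holomorphic_cong[OF refl, of _ _ "F 0"]) (auto simp: ZF)
    show "(\<lambda>s. (s - 1) * dirichlet s) holomorphic_on {s. Re s > 1}"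
      by (intro holomorphic_intros holomorphic_dirichlet)
    show "Z s = (s - 1) * dirichlet s" if "s \<in> {s. Re s > 2}" for s
      using that Feq[of s 0] ZF[of 0 s] by simp
  qed (use that in \<open>auto simp: open_halfspace_Re_gt\<close>)
  ultimately show thesis using that by metis
qed

text \<open>
  The description that defines \<^const>\<open>zeta\<close> is satisfied by \<open>Z s / (s - 1)\<close> with \<open>Z\<close> entire, and by
  nothing else because the plane without 1 is connected.
\<close>
lemma zeta_characterization:
  shows holomorphic_zeta: "zeta holomorphic_on - {1}"
    and zeta_eq_dirichlet: "Re s > 1 \<Longrightarrow> zeta s = dirichlet s"
proof -
  define P where "P f \<longleftrightarrow> f holomorphic_on (- {1}) \<and>
      (\<forall>s. Re s > 1 \<longrightarrow> f s = (\<Sum>n. 1 / of_nat (Suc n) powr s)) \<and> f 1 = 0"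
    for f :: "complex \<Rightarrow> complex"
  obtain Z where Z: "Z holomorphic_on UNIV" "\<And>s. Re s > 1 \<Longrightarrow> Z s = (s - 1) * dirichlet s"
    using entire_continuation by blast
  define E where "E s = (if s = 1 then 0 else Z s / (s - 1))" for s
  have "(\<lambda>s. Z s / (s - 1)) holomorphic_on - {1}"
    by (intro holomorphic_intros holomorphic_on_subset[OF Z(1)]) auto
  then have "E holomorphic_on - {1}"
    by (subst holomorphic_cong[OF refl, of _ _ "\<lambda>s. Z s / (s - 1)"]) (auto simp: E_def)
  moreover have "E s = (\<Sum>n. 1 / of_nat (Suc n) powr s)" if "Re s > 1" for s
  proof -
    have "s \<noteq> 1" using that by auto
    then show ?thesis using Z(2)[OF that] by (simp add: E_def dirichlet_def)
  qed
  ultimately have PE: "P E" by (simp add: P_def E_def)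
  have uniq: "f = E" if "P f" for f
  proof
    fix s
    show "f s = E s"
    proof (cases "s = 1")
      case False
      show ?thesis
      proof (rule analytic_continuation_open[where s = "{s. Re s > 1}" and s' = "- {1}"
                                          and f = f and g = E])
        show "{s. Re s > 1} \<noteq> {}" by (auto intro: exI[of _ 2])
        show "connected (- {1::complex})"
          by (rule connected_punctured_universe) simp
      qed (use that PE False in \<open>auto simp: P_def open_halfspace_Re_gt\<close>)
    qed (use that PE in \<open>auto simp: P_def\<close>)
  qed
  have "zeta = (THE f. P f)" unfolding zeta_def P_def ..
  also have "\<dots> = E" using PE uniq by (rule the_equality)
  finally have "P zeta" using PE by simp
  then show "zeta holomorphic_on - {1}" "Re s > 1 \<Longrightarrow> zeta s = dirichlet s"
    by (auto simp: P_def dirichlet_def)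
qed

lemma zeta_right_halfplane:
  assumes "Re s > 0" "s \<noteq> 1"
  shows "(s - 1) * zeta s = 1 + (\<Sum>n. powr_rem 2 (s - 1) n)"
proof (rule analytic_continuation_open[where s = "{s. Re s > 2}" and s' = "{s. Re s > 0} - {1}"
                                    and f = "\<lambda>s. (s - 1) * zeta s"
                                    and g = "\<lambda>s. 1 + (\<Sum>n. powr_rem 2 (s - 1) n)"])
  show "{s. Re s > 2} \<noteq> {}" by (auto intro: exI[of _ 3])
  show "connected ({s. Re s > 0} - {1::complex})"
    by (intro connected_open_delete convex_connected convex_halfspace_Re_gt open_halfspace_Re_gt) simp
  show "(\<lambda>s. (s - 1) * zeta s) holomorphic_on {s. Re s > 0} - {1}"
    by (intro holomorphic_intros holomorphic_on_subset[OF holomorphic_zeta]) auto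
  show "(\<lambda>s. 1 + (\<Sum>n. powr_rem 2 (s - 1) n)) holomorphic_on {s. Re s > 0} - {1}"
    unfolding numeral_2_eq_2
    by (intro holomorphic_intros
          holomorphic_on_compose_gen[OF _ holomorphic_powr_rem_sum, unfolded o_def]) auto
  show "(s - 1) * zeta s = 1 + (\<Sum>n. powr_rem 2 (s - 1) n)" if "s \<in> {s. Re s > 2}" for s
    using that dirichlet_shift[of s 0] by (simp add: zeta_eq_dirichlet numeral_2_eq_2)
qed (use assms in \<open>auto simp: open_halfspace_Re_gt intro!: open_Diff\<close>)

text \<open>
  In the strip the remainder series of order 2 converges absolutely, and its terms are bounded by
  \<open>\<bar>s - 1\<bar> \<bar>s\<bar>\<close> times a fixed summable sequence. Division by \<open>s - 1\<close> leaves linear growth.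
\<close>
lemma zeta_vertical_growth:
  assumes \<sigma>: "0 < \<sigma>" "\<sigma> < 1"
  shows "\<exists>A>0. \<forall>y. cmod (zeta (Complex \<sigma> y)) \<le> A * (1 + \<bar>y\<bar>)"
proof -
  define S where "S = (\<Sum>n. real (Suc n) powr (- 1 - \<sigma>))"
  have sm: "summable (\<lambda>n. real (Suc n) powr (- 1 - \<sigma>))"
    by (rule summable_Suc_powr) (use \<sigma> in simp)
  have S: "S \<ge> 0" unfolding S_def by (rule suminf_nonneg[OF sm]) simp
  have "cmod (zeta (Complex \<sigma> y)) \<le> (1 / (1 - \<sigma>) + S) * (1 + \<bar>y\<bar>)" for y
  proof -
    define s where "s = Complex \<sigma> y"
    have s: "Re s = \<sigma>" "Im s = y" "s \<noteq> 1" using \<sigma> by (auto simp: s_def complex_eq_iff)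
    have bd: "norm (powr_rem 2 (s - 1) n)
            \<le> norm (s - 1) * norm s * real (Suc n) powr (- 1 - \<sigma>)" for n
    proof -
      have "- (s - 1) gchoose Suc 1 = (s - 1) * s / 2"
        by (simp add: gbinomial_Suc atLeast0_atMost_Suc fact_numeral field_simps)
      note norm_powr_rem_le[of "s - 1" 1 n, unfolded this]
      then show ?thesis
        using \<sigma> s by (simp add: numeral_2_eq_2 norm_mult norm_divide)
    qed
    have "norm (\<Sum>n. powr_rem 2 (s - 1) n)
           \<le> (\<Sum>n. norm (s - 1) * norm s * real (Suc n) powr (- 1 - \<sigma>))"
      by (intro norm_suminf_le bd summable_mult sm)
    also have "\<dots> = norm (s - 1) * norm s * S"
      unfolding S_def by (rule suminf_mult[OF sm])
    finally have 1: "norm (\<Sum>n. powr_rem 2 (s - 1) n) \<le> norm (s - 1) * norm s * S" .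
    have "norm (s - 1) * cmod (zeta s) = norm (1 + (\<Sum>n. powr_rem 2 (s - 1) n))"
      using zeta_right_halfplane[of s] s \<sigma> by (simp flip: norm_mult)
    also have "\<dots> \<le> 1 + norm (s - 1) * norm s * S"
      using norm_triangle_ineq[of 1 "\<Sum>n. powr_rem 2 (s - 1) n"] 1 by simp
    finally have "cmod (zeta s) \<le> 1 / norm (s - 1) + norm s * S"
      using s by (simp add: field_simps)
    also have "\<dots> \<le> 1 / (1 - \<sigma>) * (1 + \<bar>y\<bar>) + (1 + \<bar>y\<bar>) * S"
    proof (intro add_mono mult_right_mono S)
      have "1 - \<sigma> \<le> norm (s - 1)" using abs_Re_le_cmod[of "s - 1"] s \<sigma> by simp
      then have "1 / norm (s - 1) \<le> 1 / (1 - \<sigma>)" using \<sigma> by (intro frac_le) auto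
      also have "\<dots> \<le> 1 / (1 - \<sigma>) * (1 + \<bar>y\<bar>)" using \<sigma> by (simp add: divide_right_mono)
      finally show "1 / norm (s - 1) \<le> 1 / (1 - \<sigma>) * (1 + \<bar>y\<bar>)" .
      show "norm s \<le> 1 + \<bar>y\<bar>" using cmod_le[of s] s \<sigma> by simp
    qed
    finally show ?thesis by (simp add: s_def algebra_simps)
  qed
  moreover have "1 / (1 - \<sigma>) + S > 0" using \<sigma> S by (simp add: add_pos_nonneg)
  ultimately show ?thesis by blast
qed

section \<open>Size of the Gamma function on vertical lines\<close>

lemma norm_rGamma_imaginary:
  assumes "y \<ge> 0"
  shows "(cmod (rGamma (\<i> * of_real y)))\<^sup>2 = y * sinh (pi * y) / pi"
proof -
  define z where "z = \<i> * complex_of_real y"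
  have "rGamma (- z) = cnj (rGamma z)" by (simp add: cnj_rGamma z_def)
  then have "(cmod (rGamma z))\<^sup>2 = cmod (rGamma z * rGamma (- z))"
    by (simp add: norm_mult power2_eq_square)
  also have "\<dots> = cmod (-z * sin (of_real pi * z) / of_real pi)"
    by (simp only: rGamma_reflection_complex')
  also have "of_real pi * z = \<i> * of_real (pi * y)" by (simp add: z_def)
  also have "sin (\<i> * of_real (pi * y)) = \<i> * of_real (sinh (pi * y))"
    by (simp add: sin_i_times sinh_field_def exp_minus flip: exp_of_real)
  also have "cmod (-z * (\<i> * of_real (sinh (pi * y))) / of_real pi) = y * sinh (pi * y) / pi"
    using assms by (simp add: z_def norm_mult norm_divide)
  finally show ?thesis by (simp add: z_def)
qed

text \<open>
  A reverse of Bernoulli's inequality \<open>(1 + u) powr x \<le> 1 + x * u\<close>, at the price of an error that is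
  quadratic in \<open>u\<close> in the exponent.
\<close>
lemma one_plus_scaled_le_powr:
  fixes u x :: real
  assumes "u \<ge> 0" "0 \<le> x" "x \<le> 1"
  shows "1 + x * u \<le> exp (u\<^sup>2) * (1 + u) powr x"
proof -
  have "u - u\<^sup>2 \<le> ln (1 + u)"
  proof (cases "u \<le> 1")
    case True
    then show ?thesis using assms by (intro ln_one_plus_pos_lower_bound)
  next
    case False
    then have "u \<le> u\<^sup>2" by (simp add: power2_eq_square)
    moreover have "0 \<le> ln (1 + u)" using assms by simp
    ultimately show ?thesis by linarith
  qed
  then have "x * (u - u\<^sup>2) \<le> x * ln (1 + u)" using assms by (intro mult_left_mono)
  moreover have "x * u\<^sup>2 \<le> u\<^sup>2" using assms by (simp add: mult_left_le_one_le)
  ultimately have "x * u \<le> u\<^sup>2 + x * ln (1 + u)" by (simp add: algebra_simps)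
  then have "exp (x * u) \<le> exp (u\<^sup>2) * (1 + u) powr x"
    using assms by (simp add: powr_def flip: exp_add)
  with exp_ge_add_one_self[of "x * u"] show ?thesis by linarith
qed

text \<open>
  The factors \<open>\<bar>k + x + \<i> t\<bar>\<^sup>2\<close> of the Gamma product at real part \<open>x\<close> are nearly dominated by the
  geometric interpolation between those at real parts 0 and 1. With \<open>A = k\<^sup>2 + t\<^sup>2\<close>, consecutive values
  of \<open>A\<close> have the ratio \<open>1 + u\<close> where \<open>u = (2 * k + 1) / A\<close>, and \<open>u\<^sup>2 \<le> 6 / A\<close>. The resulting errors
  are summable over \<open>k\<close>, uniformly in \<open>t \<ge> 1\<close>.
\<close>
lemma shifted_square_interpolation:
  fixes k t x :: real
  assumes "k \<ge> 0" "t \<ge> 1" "0 \<le> x" "x \<le> 1"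
  shows "(k + x)\<^sup>2 + t\<^sup>2
    \<le> exp (6 / (k\<^sup>2 + 1)) * ((k\<^sup>2 + t\<^sup>2) powr (1 - x) * ((k + 1)\<^sup>2 + t\<^sup>2) powr x)"
proof -
  define A where "A = k\<^sup>2 + t\<^sup>2"
  define u where "u = (2 * k + 1) / A"
  have t2: "t\<^sup>2 \<ge> 1" using assms by simp
  have A: "A > 0" "A \<ge> k\<^sup>2 + 1" "k\<^sup>2 + 1 > 0" 
    using t2 zero_le_power2[of k] unfolding A_def by linarith+
  have u: "u \<ge> 0" using assms A by (simp add: u_def)
  have B: "A * (1 + u) = (k + 1)\<^sup>2 + t\<^sup>2"
    using A by (simp add: u_def field_simps) (simp add: A_def power2_eq_square algebra_simps)
  have "x\<^sup>2 \<le> x" using assms by (simp add: power2_eq_square mult_left_le)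
  moreover have "A * (1 + x * u) = A + x * (2 * k + 1)"
    using A by (simp add: u_def field_simps)
  ultimately have "(k + x)\<^sup>2 + t\<^sup>2 \<le> A * (1 + x * u)"
    by (simp add: A_def power2_eq_square algebra_simps)
  also have "\<dots> \<le> A * (exp (u\<^sup>2) * (1 + u) powr x)"
    using A u assms by (intro mult_left_mono one_plus_scaled_le_powr) auto
  also have "\<dots> = exp (u\<^sup>2) * (A powr (1 - x) * (A * (1 + u)) powr x)"
    using A u by (simp add: powr_mult powr_diff)
  also have "\<dots> \<le> exp (6 / (k\<^sup>2 + 1)) * (A powr (1 - x) * (A * (1 + u)) powr x)"
  proof (intro mult_right_mono)
    have "2 * (2 * k) \<le> 2 * (k\<^sup>2 + 1)" using zero_le_power2[of "k - 1"] by (simp add: power2_diff)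
    then have "(2 * k + 1)\<^sup>2 \<le> 6 * A" using A(2) by (simp add: power2_eq_square algebra_simps)
    then have "u\<^sup>2 \<le> 6 * A / A\<^sup>2" unfolding u_def power_divide by (rule divide_right_mono) simp
    also have "\<dots> = 6 / A" by (simp add: power2_eq_square)
    also have "\<dots> \<le> 6 / (k\<^sup>2 + 1)" using A by (intro divide_left_mono) auto
    finally show "exp (u\<^sup>2) \<le> exp (6 / (k\<^sup>2 + 1))" by simp
  qed simp
  finally show ?thesis by (simp add: A_def B[unfolded A_def])
qed

lemma prod_telescope_powr:
  fixes A :: "nat \<Rightarrow> real"
  assumes "\<And>k. A k > 0"
  shows "(\<Prod>k\<le>n. A k powr (1 - x) * A (Suc k) powr x) = (\<Prod>k\<le>n. A k) * (A (Suc n) / A 0) powr x"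
proof (induction n)
  case 0
  show ?case using assms[of 0] assms[of 1] by (simp add: powr_diff powr_divide)
next
  case (Suc n)
  have "A (Suc n) powr (1 - x) * A (Suc (Suc n)) powr x * (A (Suc n) / A 0) powr x
          = A (Suc n) * (A (Suc (Suc n)) / A 0) powr x"
    using assms[of "Suc n"] assms[of 0] assms[of "Suc (Suc n)"]
    by (simp add: powr_diff powr_divide)
  then show ?case
    unfolding prod.atMost_Suc Suc.IH by algebra
qed

lemma norm_pochhammer_squared:
  "(cmod (pochhammer (of_real x + \<i> * of_real t) (Suc n)))\<^sup>2 = (\<Prod>k\<le>n. (real k + x)\<^sup>2 + t\<^sup>2)"
proof -
  have "(cmod (of_real x + \<i> * of_real t + of_nat k))\<^sup>2 = (real k + x)\<^sup>2 + t\<^sup>2" for k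
    by (simp add: cmod_power2 add.commute)
  then show ?thesis
    by (simp add: pochhammer_prod atLeast0LessThan lessThan_Suc_atMost prod_power_distrib
          flip: prod_norm)
qed

text \<open>
  Squares avoid the square roots in the moduli \<open>\<bar>k + x + \<i> t\<bar>\<close>.
\<close>
lemma norm_rGamma_series_squared:
  assumes "n > 0"
  shows "(cmod (rGamma_series (of_real x + \<i> * of_real t) n))\<^sup>2
           = (\<Prod>k\<le>n. (real k + x)\<^sup>2 + t\<^sup>2) / ((fact n)\<^sup>2 * (real n)\<^sup>2 powr x)"
proof -
  have "exp (x * ln (real n)) ^ 2 = (real n)\<^sup>2 powr x"
    using assms by (simp add: powr_def ln_realpow mult.left_commute flip: exp_double)
  then show ?thesis
    by (simp add: rGamma_series_def norm_divide norm_mult power_divide power_mult_distrib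
          norm_exp_eq_Re norm_pochhammer_squared)
qed

text \<open>
  One half of Stirling's formula on vertical lines. In Euler's product for the reciprocal Gamma function
  the interpolated factors telescope to the product on the imaginary axis times
  \<open>((n + 1)\<^sup>2 + t\<^sup>2) / t\<^sup>2\<close> to the power \<open>x\<close>; the denominator \<open>n powr (2 * x)\<close> in Euler's product cancels the growth in \<open>n\<close> and leaves \<open>t powr (-2 * x)\<close>. The accumulated interpolation errors are
  a constant.
\<close>
lemma rGamma_vertical_comparison:
  obtains C :: real where "C > 0"
    "\<And>x t. 0 \<le> x \<Longrightarrow> x \<le> 1 \<Longrightarrow> t \<ge> 1 \<Longrightarrow>
        (cmod (rGamma (of_real x + \<i> * of_real t)))\<^sup>2
          \<le> C * t powr (-2 * x) * (cmod (rGamma (\<i> * of_real t)))\<^sup>2"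
proof -
  have "summable (\<lambda>k. inverse (real k ^ 2))" by (rule inverse_power_summable) simp
  then have sm: "summable (\<lambda>k. 6 / ((real k)\<^sup>2 + 1))"
    by (rule summable_comparison_test_ev[rotated, OF summable_mult[of _ 6]])
       (auto intro!: eventually_sequentiallyI[of 1] frac_le simp flip: divide_inverse)
  define S where "S = (\<Sum>k. 6 / ((real k)\<^sup>2 + 1))"
  have main: "(cmod (rGamma (of_real x + \<i> * of_real t)))\<^sup>2
          \<le> (5 * exp S) * t powr (-2 * x) * (cmod (rGamma (\<i> * of_real t)))\<^sup>2"
    if x: "0 \<le> x" "x \<le> 1" and t: "t \<ge> 1" for x t :: real
  proof (rule tendsto_le[OF sequentially_bot])
    show "(\<lambda>n. (cmod (rGamma_series (of_real x + \<i> * of_real t) n))\<^sup>2)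
            \<longlonglongrightarrow> (cmod (rGamma (of_real x + \<i> * of_real t)))\<^sup>2"
      by (intro tendsto_intros)
    show "(\<lambda>n. (5 * exp S) * t powr (-2 * x) * (cmod (rGamma_series (\<i> * of_real t) n))\<^sup>2)
            \<longlonglongrightarrow> (5 * exp S) * t powr (-2 * x) * (cmod (rGamma (\<i> * of_real t)))\<^sup>2"
      by (intro tendsto_intros)
    show "\<forall>\<^sub>F n in sequentially. (cmod (rGamma_series (of_real x + \<i> * of_real t) n))\<^sup>2
            \<le> (5 * exp S) * t powr (-2 * x) * (cmod (rGamma_series (\<i> * of_real t) n))\<^sup>2"
      using eventually_ge_at_top[of "nat \<lceil>t\<rceil>"]
    proof eventually_elim
      case (elim n)
      then have n: "real n \<ge> t" "real n \<ge> 1" "n > 0" using t by linarith+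
      define A where "A k = (real k)\<^sup>2 + t\<^sup>2" for k
      have A: "A k > 0" for k using t by (auto simp: A_def intro!: add_nonneg_pos)
      have prod_A: "0 \<le> (\<Prod>k\<le>n. A k)" by (intro prod_nonneg less_imp_le A)
      have "(\<Prod>k\<le>n. (real k + x)\<^sup>2 + t\<^sup>2)
              \<le> (\<Prod>k\<le>n. exp (6 / ((real k)\<^sup>2 + 1)) * (A k powr (1 - x) * A (Suc k) powr x))"
      proof (intro prod_mono conjI)
        fix k
        show "(real k + x)\<^sup>2 + t\<^sup>2
                \<le> exp (6 / ((real k)\<^sup>2 + 1)) * (A k powr (1 - x) * A (Suc k) powr x)"
          using shifted_square_interpolation[of "real k", OF _ t x] by (simp add: A_def add.commute)
      qed simp
      also have "\<dots> = exp (\<Sum>k\<le>n. 6 / ((real k)\<^sup>2 + 1)) * ((\<Prod>k\<le>n. A k) * (A (Suc n) / A 0) powr x)"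
        by (simp only: prod.distrib[of "\<lambda>k. exp (6 / ((real k)\<^sup>2 + 1))"] exp_sum[OF finite_atMost, symmetric]
              prod_telescope_powr[of A, OF A])
      also have "\<dots> \<le> exp S * ((\<Prod>k\<le>n. A k) * (5 * (real n)\<^sup>2 / t\<^sup>2) powr x)"
      proof (intro mult_mono)
        show "exp (\<Sum>k\<le>n. 6 / ((real k)\<^sup>2 + 1)) \<le> exp S"
          unfolding S_def exp_le_cancel_iff by (intro sum_le_suminf sm) (auto simp: add_nonneg_nonneg)
        \<comment> \<open>For \<open>n \<ge> t\<close> one has \<open>(n + 1)\<^sup>2 + t\<^sup>2 \<le> 4 n\<^sup>2 + n\<^sup>2\<close>, which explains the factor 5.\<close>
        have "real (Suc n) \<le> 2 * real n" using n by simp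
        then have "(real (Suc n))\<^sup>2 \<le> (2 * real n)\<^sup>2" by (intro power_mono) auto
        moreover have "t\<^sup>2 \<le> (real n)\<^sup>2" using n t by (intro power_mono) auto
        ultimately have "A (Suc n) \<le> 5 * (real n)\<^sup>2" by (simp add: A_def power_mult_distrib)
        then have "A (Suc n) / A 0 \<le> 5 * (real n)\<^sup>2 / t\<^sup>2" by (simp add: A_def divide_right_mono)
        then show "(A (Suc n) / A 0) powr x \<le> (5 * (real n)\<^sup>2 / t\<^sup>2) powr x"
          using x A[of 0] A[of "Suc n"] by (intro powr_mono2) auto
      qed (use prod_A in auto)
      also have "(5 * (real n)\<^sup>2 / t\<^sup>2) powr x = 5 powr x * (real n)\<^sup>2 powr x * t powr (-2 * x)"
        using t n by (simp add: powr_divide powr_mult powr_minus_divide powr_powr flip: powr_numeral)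
      also have "exp S * ((\<Prod>k\<le>n. A k) * (5 powr x * (real n)\<^sup>2 powr x * t powr (-2 * x)))
          \<le> exp S * ((\<Prod>k\<le>n. A k) * (5 powr 1 * (real n)\<^sup>2 powr x * t powr (-2 * x)))"
        using x prod_A by (intro mult_left_mono mult_right_mono powr_mono) auto
      finally have *: "(\<Prod>k\<le>n. (real k + x)\<^sup>2 + t\<^sup>2)
         \<le> 5 * exp S * t powr (-2 * x) * (\<Prod>k\<le>n. A k) * (real n)\<^sup>2 powr x"
        by (simp add: mult_ac)
      have "(cmod (rGamma_series (of_real x + \<i> * of_real t) n))\<^sup>2
              = (\<Prod>k\<le>n. (real k + x)\<^sup>2 + t\<^sup>2) / ((fact n)\<^sup>2 * (real n)\<^sup>2 powr x)"
        using n by (intro norm_rGamma_series_squared)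
      also have "\<dots> \<le> 5 * exp S * t powr (-2 * x) * (\<Prod>k\<le>n. A k) * (real n)\<^sup>2 powr x
                         / ((fact n)\<^sup>2 * (real n)\<^sup>2 powr x)"
        by (intro divide_right_mono *) simp
      also have "\<dots> = 5 * exp S * t powr (-2 * x) * ((\<Prod>k\<le>n. A k) / (fact n)\<^sup>2)"
        using n by simp
      also have "(\<Prod>k\<le>n. A k) / (fact n)\<^sup>2 = (cmod (rGamma_series (\<i> * of_real t) n))\<^sup>2"
        using norm_rGamma_series_squared[of n 0 t] n by (simp add: A_def)
      finally show ?case .
    qed
  qed
  show thesis by (rule that[of "5 * exp S"]) (use main in auto)
qed

text \<open>
  By the comparison with the imaginary axis it is enough to treat \<open>\<Gamma>(\<i> (t - \<rho>)) / \<Gamma>(\<i> t)\<close>, where both moduli are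
  explicit. The quotient of the two hyperbolic sines is at most of order \<open>exp (pi * \<rho>)\<close>; this is the decay
  for negative \<open>\<rho>\<close> on which everything rests. The condition \<open>\<rho> \<le> 1\<close> keeps
  \<open>t - \<rho>\<close> at least \<open>t / 2\<close> and away from 0.
\<close>
lemma Gamma_quotient_bound:
  obtains C :: real where "C > 0"
    "\<And>\<sigma> t \<rho>. 0 \<le> \<sigma> \<Longrightarrow> \<sigma> \<le> 1 \<Longrightarrow> t \<ge> 2 \<Longrightarrow> \<rho> \<le> 1 \<Longrightarrow>
        cmod (Gamma (\<i> * of_real (t - \<rho>)) / Gamma (of_real \<sigma> + \<i> * of_real t))
          \<le> C * t powr (- \<sigma>) * exp (pi * \<rho> / 2)"
proof -
  obtain C :: real where C: "C > 0" and cmp: "\<And>x t. 0 \<le> x \<Longrightarrow> x \<le> 1 \<Longrightarrow> t \<ge> 1 \<Longrightarrow>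
        (cmod (rGamma (of_real x + \<i> * of_real t)))\<^sup>2
          \<le> C * t powr (-2 * x) * (cmod (rGamma (\<i> * of_real t)))\<^sup>2"
    using rGamma_vertical_comparison by blast
  have main: "cmod (Gamma (\<i> * of_real (t - \<rho>)) / Gamma (of_real \<sigma> + \<i> * of_real t))
          \<le> sqrt (4 * C) * t powr (- \<sigma>) * exp (pi * \<rho> / 2)"
    if \<sigma>: "0 \<le> \<sigma>" "\<sigma> \<le> 1" and t: "t \<ge> 2" and \<rho>: "\<rho> \<le> 1" for \<sigma> t \<rho> :: real
  proof (rule power2_le_imp_le)
    define y where "y = t - \<rho>"
    have y: "y \<ge> 1" "t \<le> 2 * y" using t \<rho> by (auto simp: y_def)
    have "1 \<le> pi * y" using y pi_ge_two mult_mono[of 1 pi 1 y] by simp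
    then have "2 \<le> exp (2 * (pi * y))" using exp_ge_add_one_self[of "2 * (pi * y)"] by linarith
    then have "2 * exp (- (pi * y)) \<le> exp (2 * (pi * y)) * exp (- (pi * y))"
      by (intro mult_right_mono) auto
    also have "\<dots> = exp (pi * y)" by (simp flip: exp_add)
    finally have shy: "exp (pi * y) \<le> 4 * sinh (pi * y)" by (simp add: sinh_field_def)
    have "sinh (pi * t) \<le> exp (pi * t) / 2" by (simp add: sinh_field_def)
    also have "\<dots> = exp (pi * \<rho>) / 2 * exp (pi * y)" by (simp add: y_def algebra_simps flip: exp_add)
    also have "\<dots> \<le> exp (pi * \<rho>) / 2 * (4 * sinh (pi * y))" by (intro mult_left_mono shy) auto
    finally have "sinh (pi * t) \<le> 2 * exp (pi * \<rho>) * sinh (pi * y)" by simp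
    then have "t * sinh (pi * t) \<le> (2 * y) * (2 * exp (pi * \<rho>) * sinh (pi * y))"
      using t y by (intro mult_mono) auto
    then have "t * sinh (pi * t) / pi \<le> (2 * y) * (2 * exp (pi * \<rho>) * sinh (pi * y)) / pi"
      by (intro divide_right_mono) auto
    then have im: "(cmod (rGamma (\<i> * of_real t)))\<^sup>2 \<le> 4 * exp (pi * \<rho>) * (cmod (rGamma (\<i> * of_real y)))\<^sup>2"
      using t y by (simp add: norm_rGamma_imaginary mult_ac)
    have "(cmod (rGamma (of_real \<sigma> + \<i> * of_real t)))\<^sup>2
            \<le> C * t powr (-2 * \<sigma>) * (4 * exp (pi * \<rho>) * (cmod (rGamma (\<i> * of_real y)))\<^sup>2)"
      using cmp[OF \<sigma>, of t] t C
      by (intro order.trans[OF _ mult_left_mono[OF im]]) auto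
    moreover have "rGamma (\<i> * of_real y) \<noteq> 0"
      using norm_rGamma_imaginary[of y] y by auto
    ultimately have "(cmod (rGamma (of_real \<sigma> + \<i> * of_real t)) / cmod (rGamma (\<i> * of_real y)))\<^sup>2
            \<le> 4 * C * t powr (-2 * \<sigma>) * exp (pi * \<rho>)"
      by (simp add: power_divide field_simps)
    also have "\<dots> = (sqrt (4 * C) * t powr (- \<sigma>) * exp (pi * \<rho> / 2))\<^sup>2"
    proof -
      have "(t powr (- \<sigma>))\<^sup>2 = t powr (-2 * \<sigma>)" by (simp add: power2_eq_square flip: powr_add)
      moreover have "(exp (pi * \<rho> / 2))\<^sup>2 = exp (pi * \<rho>)" by (simp flip: exp_double)
      ultimately show ?thesis using C by (simp add: power_mult_distrib)
    qed
    finally show "(cmod (Gamma (\<i> * of_real (t - \<rho>)) / Gamma (of_real \<sigma> + \<i> * of_real t)))\<^sup>2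
                    \<le> (sqrt (4 * C) * t powr (- \<sigma>) * exp (pi * \<rho> / 2))\<^sup>2"
      by (simp add: Gamma_def y_def norm_divide norm_inverse field_simps)
  qed (use C in auto)
  show thesis by (rule that[of "sqrt (4 * C)"]) (use main C in auto)
qed

text \<open>
  Every factor \<open>\<bar>k + \<sigma> + \<i> y\<bar>\<close> of the product for the reciprocal Gamma function is smallest at \<open>y = 0\<close>.
\<close>
lemma norm_Gamma_le_Gamma_real:
  assumes "\<sigma> > 0"
  shows "cmod (Gamma (of_real \<sigma> + \<i> * of_real y)) \<le> Gamma \<sigma>"
proof -
  have "(rGamma \<sigma>)\<^sup>2 \<le> (cmod (rGamma (of_real \<sigma> + \<i> * of_real y)))\<^sup>2"
  proof (rule tendsto_le[OF sequentially_bot])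
    show "(\<lambda>n. (cmod (rGamma_series (of_real \<sigma> + \<i> * of_real y) n))\<^sup>2)
            \<longlonglongrightarrow> (cmod (rGamma (of_real \<sigma> + \<i> * of_real y)))\<^sup>2"
      by (intro tendsto_intros)
    have "(\<lambda>n. (cmod (rGamma_series (of_real \<sigma>) n))\<^sup>2) \<longlonglongrightarrow> (cmod (rGamma (of_real \<sigma>)))\<^sup>2"
      by (intro tendsto_intros)
    then show "(\<lambda>n. (cmod (rGamma_series (of_real \<sigma>) n))\<^sup>2) \<longlonglongrightarrow> (rGamma \<sigma>)\<^sup>2"
      by (simp add: rGamma_complex_of_real)
    show "\<forall>\<^sub>F n in sequentially. (cmod (rGamma_series (of_real \<sigma>) n))\<^sup>2
            \<le> (cmod (rGamma_series (of_real \<sigma> + \<i> * of_real y) n))\<^sup>2"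
      using eventually_gt_at_top[of 0]
    proof eventually_elim
      case (elim n)
      have "(\<Prod>k\<le>n. (real k + \<sigma>)\<^sup>2) \<le> (\<Prod>k\<le>n. (real k + \<sigma>)\<^sup>2 + y\<^sup>2)"
        by (intro prod_mono) auto
      then show ?case
        using norm_rGamma_series_squared[OF elim, of \<sigma> 0] norm_rGamma_series_squared[OF elim, of \<sigma> y]
        by (simp add: divide_right_mono)
    qed
  qed
  then have "\<bar>rGamma \<sigma>\<bar> \<le> cmod (rGamma (of_real \<sigma> + \<i> * of_real y))"
    by (simp add: power2_le_iff_abs_le)
  moreover have "rGamma \<sigma> > 0" using Gamma_real_pos[OF assms] by (simp add: Gamma_def)
  ultimately show ?thesis by (simp add: Gamma_def norm_inverse le_imp_inverse_le)
qed

section \<open>The integral\<close>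

text \<open>
  The square stems from the growth of zeta. For negative \<open>\<rho>\<close> the exponential decays at rate
  \<open>pi / 2 \<ge> 1\<close>; half of the rate 1 absorbs the square and the other half remains for the integration.
  For \<open>0 \<le> \<rho> \<le> 1\<close> everything is bounded, which accounts for \<open>exp 2\<close>.
\<close>
lemma exponential_beats_square:
  fixes \<rho> :: real
  assumes "\<rho> \<le> 1"
  shows "exp (pi * \<rho> / 2) * (1 + \<bar>\<rho>\<bar>)\<^sup>2 \<le> 16 * exp 2 * exp (\<rho> / 2)"
proof -
  have "1 + \<bar>\<rho>\<bar> \<le> 4 * exp (\<bar>\<rho>\<bar> / 4)" using exp_ge_add_one_self[of "\<bar>\<rho>\<bar> / 4"] by linarith
  then have "(1 + \<bar>\<rho>\<bar>)\<^sup>2 \<le> (4 * exp (\<bar>\<rho>\<bar> / 4))\<^sup>2" by (intro power_mono) auto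
  also have "\<dots> = 16 * exp (\<bar>\<rho>\<bar> / 2)" by (simp add: power_mult_distrib flip: exp_double)
  finally have "exp (pi * \<rho> / 2) * (1 + \<bar>\<rho>\<bar>)\<^sup>2 \<le> exp (pi * \<rho> / 2) * (16 * exp (\<bar>\<rho>\<bar> / 2))"
    by (rule mult_left_mono) simp
  also have "\<dots> = 16 * exp (pi * \<rho> / 2 + \<bar>\<rho>\<bar> / 2)" by (simp add: exp_add)
  also have "pi * \<rho> / 2 + \<bar>\<rho>\<bar> / 2 \<le> 2 + \<rho> / 2"
  proof (cases "\<rho> \<ge> 0")
    case True
    then have "pi * \<rho> \<le> 4 * 1" using assms pi_less_4 by (intro mult_mono) auto
    with True show ?thesis by simp
  next
    case False
    then have "pi * \<rho> \<le> 2 * \<rho>" using pi_ge_two by (intro mult_right_mono_neg) auto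
    with False show ?thesis by linarith
  qed
  finally show ?thesis by (simp add: exp_add)
qed

lemma integrand_bound:
  assumes \<sigma>: "0 < \<sigma>" "\<sigma> < 1"
  obtains K where "K > 0" "\<And>t \<tau>. t \<ge> 2 \<Longrightarrow> t * \<tau> \<le> 1 \<Longrightarrow>
      \<bar>Re (Gamma (\<i> * of_real t - \<i> * of_real t * of_real \<tau>)
             / Gamma (of_real \<sigma> + \<i> * of_real t)
           * Gamma (of_real \<sigma> + \<i> * of_real t * of_real \<tau>))
        * (cmod (zeta (of_real \<sigma> + \<i> * of_real t * of_real \<tau>)))\<^sup>2\<bar>
        \<le> K * t powr (- \<sigma>) * exp (t / 2 * \<tau>)"
proof -
  obtain C :: real where C: "C > 0" and quot: "\<And>\<sigma> t \<rho>. 0 \<le> \<sigma> \<Longrightarrow> \<sigma> \<le> 1 \<Longrightarrow> t \<ge> 2 \<Longrightarrow> \<rho> \<le> 1 \<Longrightarrow>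
        cmod (Gamma (\<i> * of_real (t - \<rho>)) / Gamma (of_real \<sigma> + \<i> * of_real t))
          \<le> C * t powr (- \<sigma>) * exp (pi * \<rho> / 2)"
    using Gamma_quotient_bound by blast
  obtain A where A: "A > 0" and zeta: "\<And>y. cmod (zeta (Complex \<sigma> y)) \<le> A * (1 + \<bar>y\<bar>)"
    using zeta_vertical_growth[OF \<sigma>] by blast
  define K where "K = C * Gamma \<sigma> * A\<^sup>2 * (16 * exp 2)"
  have \<Gamma>: "Gamma \<sigma> > 0" using \<sigma> by (intro Gamma_real_pos)
  have main: "\<bar>Re (Gamma (\<i> * of_real t - \<i> * of_real t * of_real \<tau>)
             / Gamma (of_real \<sigma> + \<i> * of_real t)
           * Gamma (of_real \<sigma> + \<i> * of_real t * of_real \<tau>))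
        * (cmod (zeta (of_real \<sigma> + \<i> * of_real t * of_real \<tau>)))\<^sup>2\<bar>
        \<le> K * t powr (- \<sigma>) * exp (t / 2 * \<tau>)" if t: "t \<ge> 2" and \<tau>: "t * \<tau> \<le> 1" for t \<tau>
  proof -
    define \<rho> where "\<rho> = t * \<tau>"
    let ?Q = "Gamma (\<i> * of_real (t - \<rho>)) / Gamma (of_real \<sigma> + \<i> * of_real t)"
    let ?s = "of_real \<sigma> + \<i> * of_real \<rho>"
    have args: "\<i> * of_real t - \<i> * of_real t * of_real \<tau> = \<i> * of_real (t - \<rho>)"
      "of_real \<sigma> + \<i> * of_real t * of_real \<tau> = ?s"
      by (simp_all add: \<rho>_def algebra_simps)
    have "?s = Complex \<sigma> \<rho>" by (simp add: complex_eq_iff)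
    then have zeta_s: "cmod (zeta ?s) \<le> A * (1 + \<bar>\<rho>\<bar>)" using zeta by simp
    have \<rho>: "\<rho> \<le> 1" using \<tau> by (simp add: \<rho>_def)
    have "\<bar>Re (?Q * Gamma ?s) * (cmod (zeta ?s))\<^sup>2\<bar> \<le> cmod ?Q * cmod (Gamma ?s) * (cmod (zeta ?s))\<^sup>2"
      unfolding abs_mult norm_mult[symmetric] using abs_Re_le_cmod by (simp add: mult_right_mono)
    also have "\<dots> \<le> (C * t powr (- \<sigma>) * exp (pi * \<rho> / 2)) * Gamma \<sigma> * (A * (1 + \<bar>\<rho>\<bar>))\<^sup>2"
      using \<sigma> C \<Gamma> by (intro mult_mono power_mono quot[OF _ _ t \<rho>] zeta_s norm_Gamma_le_Gamma_real) auto
    also have "\<dots> = (C * Gamma \<sigma> * A\<^sup>2 * t powr (- \<sigma>)) * (exp (pi * \<rho> / 2) * (1 + \<bar>\<rho>\<bar>)\<^sup>2)"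
      by (simp add: power_mult_distrib)
    also have "\<dots> \<le> (C * Gamma \<sigma> * A\<^sup>2 * t powr (- \<sigma>)) * (16 * exp 2 * exp (\<rho> / 2))"
      using C \<Gamma> by (intro mult_left_mono exponential_beats_square \<rho>) auto
    also have "\<dots> = K * t powr (- \<sigma>) * exp (t / 2 * \<tau>)" by (simp add: K_def \<rho>_def)
    finally show ?thesis unfolding args .
  qed
  show thesis by (rule that[of K]) (use main C A \<Gamma> in \<open>auto simp: K_def\<close>)
qed

text \<open>
  The weight \<open>exp (t * \<tau> / 2)\<close> has integral at most \<open>2 * exp (1/2) / t\<close> over \<open>\<tau> \<le> 1 / t\<close>, wherever
  the interval starts. This cancels the prefactor \<open>t\<close> and makes the bound uniform in \<open>\<delta>\<close>.
\<close>
lemma I1_bound: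
  assumes \<sigma>: "0 < \<sigma>" "\<sigma> < 1"
  obtains M where "\<And>t \<delta>. t \<ge> 2 \<Longrightarrow> \<bar>I1 \<sigma> t \<delta>\<bar> \<le> M * t powr (- \<sigma>)"
proof -
  define f where "f t \<tau> = Re (Gamma (\<i> * of_real t - \<i> * of_real t * of_real \<tau>)
             / Gamma (of_real \<sigma> + \<i> * of_real t)
           * Gamma (of_real \<sigma> + \<i> * of_real t * of_real \<tau>))
        * (cmod (zeta (of_real \<sigma> + \<i> * of_real t * of_real \<tau>)))\<^sup>2" for t \<tau> :: real
  obtain K where K: "K > 0"
    and f: "\<And>t \<tau>. t \<ge> 2 \<Longrightarrow> t * \<tau> \<le> 1 \<Longrightarrow> \<bar>f t \<tau>\<bar> \<le> K * t powr (- \<sigma>) * exp (t / 2 * \<tau>)"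
    using integrand_bound[OF \<sigma>] unfolding f_def by blast
  have "\<bar>I1 \<sigma> t \<delta>\<bar> \<le> 2 * K * exp (1/2) / pi * t powr (- \<sigma>)" if t: "t \<ge> 2" for t \<delta>
  proof -
    let ?a = "- (t powr (\<delta> - 1))" and ?c = "K * t powr (- \<sigma>)"
    have "((\<lambda>\<tau>. ?c * exp (t / 2 * \<tau>)) has_integral
            ?c * (2 / t) * exp (t / 2 * (1 / t)) - ?c * (2 / t) * exp (t / 2 * ?a)) {?a..1 / t}"
    proof (rule fundamental_theorem_of_calculus)
      have "?a \<le> 0" "0 \<le> 1 / t" using t by auto
      then show "?a \<le> 1 / t" by linarith
    qed (use t in \<open>auto intro!: derivative_eq_intros
           simp flip: has_real_derivative_iff_has_vector_derivative\<close>)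
    moreover have "?c * (2 / t) * exp (t / 2 * ?a) \<ge> 0" using K t by simp
    ultimately have g: "(\<lambda>\<tau>. ?c * exp (t / 2 * \<tau>)) integrable_on {?a..1 / t}"
      "integral {?a..1 / t} (\<lambda>\<tau>. ?c * exp (t / 2 * \<tau>)) \<le> ?c * (2 / t) * exp (1 / 2)"
      using t by (auto simp: has_integral_iff)
    have "\<bar>integral {?a..1 / t} (f t)\<bar> \<le> ?c * (2 / t) * exp (1 / 2)"
    \<comment> \<open>A non-integrable function has the integral 0 by convention, so that the pointwise bound
      settles both cases.\<close>
    proof (cases "f t integrable_on {?a..1 / t}")
      case True
      have "t * \<tau> \<le> 1" if "\<tau> \<in> {?a..1 / t}" for \<tau>
        using that t by (simp add: field_simps)
      then have "norm (integral {?a..1 / t} (f t)) \<le> integral {?a..1 / t} (\<lambda>\<tau>. ?c * exp (t / 2 * \<tau>))"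
        using f[OF t] by (intro Henstock_Kurzweil_Integration.integral_norm_bound_integral True g) auto
      with g show ?thesis by simp
    next
      case False
      then show ?thesis using K t by (simp add: not_integrable_integral)
    qed
    then have "t / pi * \<bar>integral {?a..1 / t} (f t)\<bar> \<le> t / pi * (?c * (2 / t) * exp (1 / 2))"
      using t by (intro mult_left_mono) auto
    then show ?thesis
      using t by (simp add: I1_def f_def[abs_def] abs_mult) (simp add: field_simps)
  qed
  then show thesis by (rule that)
qed

theorem lemma4p1:
  "\<exists>\<delta>\<^sub>0::real. 0 < \<delta>\<^sub>0 \<and>
     (\<forall>\<delta>\<^sub>1 \<sigma>::real. 0 < \<delta>\<^sub>1 \<and> \<delta>\<^sub>1 < 1 \<and> \<delta>\<^sub>1 < \<delta>\<^sub>0 \<longrightarrow>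
        (0 < \<sigma> \<and> \<sigma> \<le> 1/2 \<longrightarrow>
           (\<lambda>t. I1 \<sigma> t \<delta>\<^sub>1) \<in> O[at_top](\<lambda>t. t powr ((2 - 4/3 * \<sigma>) * \<delta>\<^sub>1) / t powr \<sigma>)) \<and>
        (1/2 < \<sigma> \<and> \<sigma> < 1 \<longrightarrow>
           (\<lambda>t. I1 \<sigma> t \<delta>\<^sub>1) \<in> O[at_top](\<lambda>t. t powr ((5/3 - 2/3 * \<sigma>) * \<delta>\<^sub>1) / t powr \<sigma>)))"
proof -
  have key: "(\<lambda>t. I1 \<sigma> t \<delta>) \<in> O[at_top](\<lambda>t. t powr p / t powr \<sigma>)"
    if \<sigma>: "0 < \<sigma>" "\<sigma> < 1" and p: "p \<ge> 0" for \<sigma> \<delta> p :: real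
  proof -
    obtain M where M: "\<And>t \<delta>. t \<ge> 2 \<Longrightarrow> \<bar>I1 \<sigma> t \<delta>\<bar> \<le> M * t powr (- \<sigma>)"
      using I1_bound[OF \<sigma>] by blast
    show ?thesis
    proof (rule bigoI[of _ "\<bar>M\<bar>"], rule eventually_mono[OF eventually_ge_at_top[of 2]])
      fix t :: real assume t: "t \<ge> 2"
      have "\<bar>I1 \<sigma> t \<delta>\<bar> \<le> \<bar>M\<bar> * t powr (- \<sigma>)"
        using M[OF t] by (rule order.trans) (intro mult_right_mono, auto)
      also have "\<dots> \<le> \<bar>M\<bar> * (t powr p / t powr \<sigma>)"
        using ge_one_powr_ge_zero[of t p] t p
        by (intro mult_left_mono) (auto simp: powr_minus_divide divide_right_mono)
      finally show "norm (I1 \<sigma> t \<delta>) \<le> \<bar>M\<bar> * norm (t powr p / t powr \<sigma>)" by simp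
    qed
  qed
  \<comment> \<open>The coefficients \<open>2 - 4/3 * \<sigma>\<close> and \<open>5/3 - 2/3 * \<sigma>\<close> are positive on their ranges of \<open>\<sigma>\<close>.\<close>
  show ?thesis by (rule exI[of _ 1]) (auto intro!: key)
qed

end
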